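(* Let $q$ be an odd prime power. Then for all $b,c,d\in\mathbb{F}_{q^2}$, the polynomial $x^{q+1}+bx^q+cx+d\in\mathbb{F}_{q^2}[x]$ is not a permutation polynomial of $\mathbb{F}_{q^2}$.
   Context: $\mathbb{F}_{q^2}$ is the finite field with $q^2$ elements. A polynomial over $\mathbb{F}_{q^2}$ is a permutation polynomial of $\mathbb{F}_{q^2}$ if it induces a bijection of $\mathbb{F}_{q^2}$ onto itself. *)

theory Defs
  imports "HOL-Library.Cardinality" "HOL-Computational_Algebra.Polynomial" "HOL-Number_Theory.Prime_Powers"
begin

definition permutation_poly :: "'a::{field,finite} poly \<Rightarrow> bool" where
  "permutation_poly p \<longleftrightarrow> bij (poly p)"

end

theory Submission
  imports Defs
begin

text \<open>
  The power map \<open>x \<mapsto> x ^ q\<close> is a power of Frobenius, so it is an automorphism of the finite field,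
  and some \<open>r\<close> satisfies \<open>r ^ q = - c\<close>. The polynomial then factors up to a constant:
  \<open>x ^ (q + 1) + b x ^ q + c x + d = (x ^ q + c) (x + b) + (d - b c) = (x - r) ^ q (x + b) + (d - b c)\<close>.
  The product vanishes both at \<open>r\<close> and at \<open>- b\<close>, so a permutation polynomial would need \<open>r = - b\<close>.
  But then the product is \<open>(x - r) ^ (q + 1)\<close> with \<open>q + 1\<close> even, so \<open>r + 1\<close> and \<open>r - 1\<close>, which differ
  in odd characteristic, have the same image.
\<close>

lemma prime_CHAR_finite_field: "prime CHAR('a::{field,finite})"
  by (simp add: finite_imp_CHAR_pos prime_CHAR_semidom)

lemma CHAR_dvd_card_UNIV: "CHAR('a::{field,finite}) dvd CARD('a)"
proof -
  \<comment> \<open>Translation by \<open>1\<close> permutes the field, so it leaves the sum of all elements unchanged.\<close>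
  have "bij (\<lambda>x::'a. x + 1)"
    by (rule bij_plus_right)
  hence "(\<Sum>x\<in>UNIV. x + 1) = (\<Sum>x\<in>UNIV. x :: 'a)"
    by (rule sum.reindex_bij_betw)
  hence "of_nat (CARD('a)) = (0 :: 'a)"
    by (simp add: sum.distrib)
  thus ?thesis
    by (simp only: of_nat_eq_0_iff_char_dvd)
qed

lemma CHAR_power_if_CARD_primepow:
  fixes q :: nat
  assumes "primepow q" and "CARD('a::{field,finite}) = q ^ n"
  obtains k where "q = CHAR('a) ^ k"
proof -
  obtain p k where p: "prime p" "q = p ^ k"
    using assms(1) by (auto simp: primepow_def)
  have "CHAR('a) dvd p ^ (k * n)"
    using CHAR_dvd_card_UNIV[where 'a = 'a] assms(2) p(2) by (simp add: power_mult)
  hence "CHAR('a) = p"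
    using prime_CHAR_finite_field p(1) by (metis prime_dvd_power primes_dvd_imp_eq)
  with p(2) that show ?thesis by blast
qed

lemma diff_power_CHAR_power:
  fixes x y :: "'a::{field,finite}"
  assumes "q = CHAR('a) ^ k"
  shows "(x - y) ^ q = x ^ q - y ^ q"
  \<comment> \<open>Additivity is applied to \<open>(x - y) + y\<close>, which avoids the sign of \<open>(- y) ^ q\<close>.\<close>
  using freshmans_dream'[OF prime_CHAR_finite_field assms, of "x - y" y]
  by (simp add: algebra_simps)

text \<open>
  An additive map with trivial kernel is injective, and an injective self-map of a finite set
  is onto.
\<close>
lemma surj_power_CHAR_power:
  assumes "q = CHAR('a::{field,finite}) ^ k"
  shows "surj (\<lambda>x::'a. x ^ q)"
proof (rule finite_UNIV_inj_surj)
  show "inj (\<lambda>x::'a. x ^ q)"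
  proof (rule injI)
    fix x y :: 'a
    assume "x ^ q = y ^ q"
    hence "(x - y) ^ q = 0"
      by (simp add: diff_power_CHAR_power[OF assms])
    thus "x = y"
      using power_not_zero[of "x - y" q] by auto
  qed
qed simp

theorem theorem3p9:
  fixes q :: nat and b c d :: "'a::{field,finite}"
  assumes "primepow q" and "odd q" and "CARD('a) = q ^ 2"
  shows "\<not> permutation_poly (monom 1 (q + 1) + monom b q + monom c 1 + [:d:])"
proof
  let ?f = "monom 1 (q + 1) + monom b q + monom c 1 + [:d:]"
  assume "permutation_poly ?f"
  hence inj: "inj (poly ?f)"
    by (simp add: permutation_poly_def bij_is_inj)
  obtain k where q: "q = CHAR('a) ^ k"
    using CHAR_power_if_CARD_primepow assms(1,3) by blast
  obtain r :: 'a where r: "r ^ q = - c"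
    using surj_power_CHAR_power[OF q] by (metis surjD)
  have f: "poly ?f x = (x - r) ^ q * (x + b) + (d - b * c)" for x
    by (simp add: poly_monom diff_power_CHAR_power[OF q] r algebra_simps)
  have "q > 0"
    using assms(2) by (rule odd_pos)
  hence "poly ?f r = poly ?f (- b)"
    unfolding f by simp
  hence "r = - b"
    using inj by (simp only: inj_eq)
  hence "poly ?f (r + 1) = poly ?f (r - 1)"
    unfolding f using assms(2) by simp
  hence "r + 1 = r - 1"
    using inj by (simp only: inj_eq)
  hence "(1 + 1 :: 'a) = 0"
    by (simp add: algebra_simps eq_neg_iff_add_eq_0)
  hence "of_nat 2 = (0 :: 'a)"
    by simp
  hence "CHAR('a) dvd 2"
    by (simp only: of_nat_eq_0_iff_char_dvd)
  hence "CHAR('a) = 2"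
    using prime_CHAR_finite_field two_is_prime_nat primes_dvd_imp_eq by blast
  \<comment> \<open>The exponent could only be \<open>0\<close>, which is excluded because \<open>1\<close> is not a prime power.\<close>
  thus False
    using q assms(1,2) by (cases k) auto
qed

end
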